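(* Let $\mathcal{S}$ be a scenario with startperiod $A_M$, startphase $B_M$, endperiod $A_N$ and endphase $B_N$, and let $\mathcal{S}' = \mathcal{S}d$ be the scenario obtained by adding one operation d at the end of $\mathcal{S}$, with startperiod $A'_M$, startphase $B'_M$, endperiod $A'_N$ and endphase $B'_N$. If $\tfrac12\left(B_N+\tfrac12 A_N\right)$ is odd, then $$A'_M = 2A_M,\quad B'_M = B_M+\tfrac12 A_M,\quad A'_N = A_N,\quad B'_N = \tfrac12\left(B_N+\tfrac12 A_N\right).$$ If $\tfrac12\left(B_N+\tfrac12 A_N\right)$ is even, then $$A'_M = 2A_M,\quad B'_M = \left[B_M+\tfrac32 A_M\right] \bmod A'_M,\quad A'_N = A_N,\quad B'_N = \left[\tfrac12\left(B_N+\tfrac32 A_N\right)\right] \bmod A_N.$$ Here $x \bmod n$ denotes the remainder of $x$ on division by $n$, lying in $\{0,\dots,n-1\}$.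
   Context: Collatz operations on positive integers: "s" (spike) is $m\mapsto (3m+1)/2$, applied when $m$ is odd; "d" (down) is $m\mapsto m/2$, applied when $m$ is even. A scenario is a finite nonempty word in the letters s and d whose first letter is s. A realization of a scenario is a sequence of positive integers obtained from a positive odd integer $M$ (the startnumber) by performing, from left to right, the operations spelled out by the word, where at each step s is applied to an odd integer and d to an even integer, and where the final integer $N$ (the endnumber) is odd. A scenario uniquely determines integers $A_M, A_N$ (even) and $B_M, B_N$ (odd) such that, for $k=1,2,3,\dots$, the $k$-th realization (all realizations being listed in increasing order of startnumber) has startnumber $M_k=A_M k-B_M$ and endnumber $N_k=A_N k-B_N$. The integers $A_M$, $A_N$, $B_M$, $B_N$ are called the startperiod, endperiod, startphase and endphase, respectively. *)

theory Defs
  imports Main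
begin

datatype collatz_op = Spike | Down

fun collatz_step :: "collatz_op \<Rightarrow> int \<Rightarrow> int \<Rightarrow> bool" where
  "collatz_step Spike m n \<longleftrightarrow> odd m \<and> n = (3 * m + 1) div 2"
| "collatz_step Down m n \<longleftrightarrow> even m \<and> n = m div 2"

definition scenario :: "collatz_op list \<Rightarrow> bool" where
  "scenario w \<longleftrightarrow> w \<noteq> [] \<and> hd w = Spike"

text \<open>A realization records all the numbers visited, so it is one longer than the word;
  the startnumber is its head and the endnumber is its last entry.\<close>

definition realization :: "collatz_op list \<Rightarrow> int list \<Rightarrow> bool" where
  "realization w ms \<longleftrightarrow>
     length ms = Suc (length w) \<and>
     (\<forall>m \<in> set ms. m > 0) \<and>
     odd (hd ms) \<and>
     (\<forall>i < length w. collatz_step (w ! i) (ms ! i) (ms ! Suc i)) \<and>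
     odd (last ms)"

text \<open>\<open>R k\<close>, for \<open>k = 1, 2, 3, \<dots>\<close>, is the complete list of realizations in increasing order of
  startnumber. The value \<open>R 0\<close> is irrelevant.\<close>

definition lists_realizations :: "collatz_op list \<Rightarrow> (nat \<Rightarrow> int list) \<Rightarrow> bool" where
  "lists_realizations w R \<longleftrightarrow>
     R ` {1..} = {ms. realization w ms} \<and>
     strict_mono_on {1..} (\<lambda>k. hd (R k))"

definition scenario_parameters ::
    "collatz_op list \<Rightarrow> int \<Rightarrow> int \<Rightarrow> int \<Rightarrow> int \<Rightarrow> bool" where
  "scenario_parameters w A_M B_M A_N B_N \<longleftrightarrow>
     even A_M \<and> odd B_M \<and> even A_N \<and> odd B_N \<and>
     (\<exists>R. lists_realizations w R \<and>
        (\<forall>k \<ge> 1. hd (R k) = A_M * int k - B_M \<and> last (R k) = A_N * int k - B_N))"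

text \<open>For a scenario the parameters exist and are unique, with \<open>A_M = 2 ^ Suc (length w)\<close> and
  \<open>A_N = 2 * 3 ^ count_list w Spike\<close>. In particular half of \<open>A_N\<close> is odd, so that
  \<open>B_N\<close> plus any odd multiple of half of \<open>A_N\<close> is even, and halving it by \<open>div 2\<close> is exact.\<close>

definition startperiod :: "collatz_op list \<Rightarrow> int" where
  "startperiod w = (THE A_M. \<exists>B_M A_N B_N. scenario_parameters w A_M B_M A_N B_N)"

definition startphase :: "collatz_op list \<Rightarrow> int" where
  "startphase w = (THE B_M. \<exists>A_M A_N B_N. scenario_parameters w A_M B_M A_N B_N)"

definition endperiod :: "collatz_op list \<Rightarrow> int" where
  "endperiod w = (THE A_N. \<exists>A_M B_M B_N. scenario_parameters w A_M B_M A_N B_N)"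

definition endphase :: "collatz_op list \<Rightarrow> int" where
  "endphase w = (THE B_N. \<exists>A_M B_M A_N. scenario_parameters w A_M B_M A_N B_N)"

end

theory Submission imports Defs begin

text \<open>
  Dropping the condition that the endnumber be odd, the pairs (startnumber, endnumber) realizing
  a word with \<open>n\<close> letters, \<open>c\<close> of them spikes, form an arithmetic progression of step
  \<open>(P, Q) = (2 ^ n, 3 ^ c)\<close> whose first positive term lies in \<open>(0, P] \<times> (0, Q]\<close>; each letter
  appended halves the progression, because \<open>Q\<close> is odd. Hence the progression is
  \<open>(P s - X, Q s - Y)\<close> with \<open>X = B\<^sub>M\<close> and \<open>Y = B\<^sub>N\<close>, the realizations of \<open>S\<close> are the terms with
  \<open>s\<close> even, and those of \<open>S d\<close> come from the terms with \<open>s\<close> in one fixed odd class modulo 4.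
  The class is the one for which \<open>(Q s - Y) / 2\<close> is odd.
\<close>

section \<open>Paths spelled out by a word\<close>

definition path :: "collatz_op list \<Rightarrow> int list \<Rightarrow> bool" where
  "path w ms \<longleftrightarrow> length ms = Suc (length w) \<and>
     (\<forall>i < length w. collatz_step (w ! i) (ms ! i) (ms ! Suc i))"

text \<open>No sign or parity is imposed on the ends, so that the pairs \<open>(M, N)\<close> fill a
  two-sided arithmetic progression; positivity and odd ends return through
  \<open>realization_iff\<close>.\<close>

definition reaches :: "collatz_op list \<Rightarrow> int \<Rightarrow> int \<Rightarrow> bool" where
  "reaches w M N \<longleftrightarrow> (\<exists>ms. path w ms \<and> hd ms = M \<and> last ms = N)"

lemma path_not_Nil: "path w ms \<Longrightarrow> ms \<noteq> []"
  by (auto simp: path_def)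

lemma path_Nil_iff: "path [] ms \<longleftrightarrow> (\<exists>m. ms = [m])"
  by (auto simp: path_def length_Suc_conv)

lemma path_snoc_iff:
  "path (w @ [x]) ms \<longleftrightarrow>
     (\<exists>ms' N. ms = ms' @ [N] \<and> path w ms' \<and> collatz_step x (last ms') N)"
proof (cases ms rule: rev_exhaust)
  case Nil
  then show ?thesis by (auto simp: path_def)
next
  case (snoc ms' N)
  have "path (w @ [x]) (ms' @ [N]) \<longleftrightarrow> path w ms' \<and> collatz_step x (last ms') N"
  proof (cases "length ms' = Suc (length w)")
    case True
    then have "last ms' = ms' ! length w"
      by (metis diff_Suc_1 last_conv_nth length_0_conv nat.distinct(1))
    moreover have "(\<forall>i < length w. collatz_step ((w @ [x]) ! i) ((ms' @ [N]) ! i) ((ms' @ [N]) ! Suc i))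
        \<longleftrightarrow> (\<forall>i < length w. collatz_step (w ! i) (ms' ! i) (ms' ! Suc i))"
      using True by (intro all_cong) (simp add: nth_append)
    ultimately show ?thesis
      using True by (auto simp: path_def All_less_Suc nth_append)
  next
    case False
    then show ?thesis by (auto simp: path_def)
  qed
  with snoc show ?thesis by simp
qed

lemma reaches_Nil: "reaches [] M N \<longleftrightarrow> N = M"
  by (auto simp: reaches_def path_Nil_iff)

lemma reaches_snoc: "reaches (w @ [x]) M N \<longleftrightarrow> (\<exists>K. reaches w M K \<and> collatz_step x K N)"
proof
  assume "reaches (w @ [x]) M N"
  then show "\<exists>K. reaches w M K \<and> collatz_step x K N"
    by (fastforce simp: reaches_def path_snoc_iff dest: path_not_Nil)
next
  assume "\<exists>K. reaches w M K \<and> collatz_step x K N"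
  then obtain ms where ms: "path w ms" "hd ms = M" "collatz_step x (last ms) N"
    by (auto simp: reaches_def)
  then have "path (w @ [x]) (ms @ [N])" "hd (ms @ [N]) = M"
    using path_not_Nil[of w ms] by (auto simp: path_snoc_iff)
  then show "reaches (w @ [x]) M N"
    unfolding reaches_def by (metis last_snoc)
qed

lemma reaches_snoc_Down: "reaches (w @ [Down]) M N \<longleftrightarrow> reaches w M (2 * N)"
  by (auto simp: reaches_snoc elim!: evenE)

lemma collatz_step_fun: "collatz_step x m n \<Longrightarrow> collatz_step x m n' \<Longrightarrow> n = n'"
  by (cases x) auto

lemma collatz_step_pos: "collatz_step x m n \<Longrightarrow> m > 0 \<Longrightarrow> n > 0"
  by (cases x) (auto elim!: evenE)

text \<open>Each operation is deterministic (\<open>collatz_step_fun\<close>). This lets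
  realizations be compared through their startnumbers alone.\<close>

lemma path_unique: "path w ms \<Longrightarrow> path w ms' \<Longrightarrow> hd ms = hd ms' \<Longrightarrow> ms = ms'"
proof (induction w arbitrary: ms ms' rule: rev_induct)
  case Nil
  then show ?case by (auto simp: path_Nil_iff)
next
  case (snoc x w)
  from snoc.prems(1) obtain us u where
    u: "ms = us @ [u]" "path w us" "collatz_step x (last us) u"
    by (auto simp: path_snoc_iff)
  from snoc.prems(2) obtain vs v where
    v: "ms' = vs @ [v]" "path w vs" "collatz_step x (last vs) v"
    by (auto simp: path_snoc_iff)
  have "us = vs"
    using snoc.IH[OF u(2) v(2)] snoc.prems(3) u v path_not_Nil by fastforce
  with u v show ?case using collatz_step_fun by blast
qed

lemma path_pos: "path w ms \<Longrightarrow> hd ms > 0 \<Longrightarrow> m \<in> set ms \<Longrightarrow> m > 0"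
proof (induction w arbitrary: ms m rule: rev_induct)
  case Nil
  then show ?case by (auto simp: path_Nil_iff)
next
  case (snoc x w)
  from snoc.prems(1) obtain us u where
    u: "ms = us @ [u]" "path w us" "collatz_step x (last us) u"
    by (auto simp: path_snoc_iff)
  have pos: "\<And>k. k \<in> set us \<Longrightarrow> k > 0"
    using snoc.IH[OF u(2)] snoc.prems(2) u(1) path_not_Nil[OF u(2)] by auto
  then have "u > 0"
    using u path_not_Nil collatz_step_pos last_in_set by blast
  with pos snoc.prems(3) u(1) show ?case by auto
qed

lemma realization_iff:
  "realization w ms \<longleftrightarrow> path w ms \<and> hd ms > 0 \<and> odd (hd ms) \<and> odd (last ms)"
proof -
  have "(\<forall>m \<in> set ms. m > 0) \<longleftrightarrow> hd ms > 0" if "path w ms"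
    using path_pos[OF that] path_not_Nil[OF that] by auto
  then show ?thesis unfolding realization_def path_def by blast
qed

text \<open>The initial spike demands an odd argument, so the parity condition on the startnumber
  comes for free.\<close>

lemma scenario_reaches_odd:
  assumes "scenario w" "reaches w M N"
  shows "odd M"
proof -
  from assms obtain v where w: "w = Spike # v"
    by (cases w) (auto simp: scenario_def)
  from assms(2) obtain ms where ms: "path w ms" "hd ms = M"
    by (auto simp: reaches_def)
  from ms(1) w have "collatz_step Spike (ms ! 0) (ms ! 1)"
    unfolding path_def by (metis One_nat_def length_Cons nth_Cons_0 zero_less_Suc)
  with ms path_not_Nil[of w ms] show ?thesis by (simp add: hd_conv_nth)
qed

section \<open>Uniqueness of the enumeration and of the parameters\<close>

text \<open>Once the earlier values agree, the next value of either function must be the least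
  remaining element of the common image.\<close>

lemma strict_mono_range_unique:
  fixes f g :: "nat \<Rightarrow> int"
  assumes f: "strict_mono_on {1..} f" and g: "strict_mono_on {1..} g"
    and fg: "f ` {1..} = g ` {1..}" and n: "n \<ge> 1"
  shows "f n = g n"
  using n
proof (induction n rule: less_induct)
  case (less n)
  \<comment> \<open>Stated for arbitrary \<open>h\<close> and \<open>h'\<close> so that it can be
    used in both directions and closed by antisymmetry.\<close>
  have le: "h n \<le> h' n"
    if h: "strict_mono_on {1..} h" and h': "strict_mono_on {1..} h'"
      and img: "h ` {1..} = h' ` {1..}"
      and IH: "\<And>m. m < n \<Longrightarrow> 1 \<le> m \<Longrightarrow> h m = h' m" for h h' :: "nat \<Rightarrow> int"
  proof -
    have "h' n \<in> h ` {1..}" using less.prems img by auto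
    then obtain m where m: "m \<ge> 1" "h' n = h m" by auto
    have "\<not> m < n"
    proof
      assume "m < n"
      with m IH have "h' n = h' m" by simp
      moreover have "h' m < h' n"
        using strict_mono_onD[OF h', of m n] m(1) \<open>m < n\<close> by simp
      ultimately show False by simp
    qed
    then have "h n \<le> h m"
      using strict_mono_onD[OF h, of n m] less.prems m by (cases "n = m") auto
    with m show ?thesis by simp
  qed
  show ?case
    using le[OF f g fg] le[OF g f fg[symmetric]] less.IH by (simp add: order_antisym)
qed

lemma lists_realizations_unique:
  assumes R: "lists_realizations w R" and R': "lists_realizations w R'" and k: "k \<ge> 1"
  shows "R k = R' k"
proof -
  have "(\<lambda>k. hd (R k)) ` {1..} = hd ` (R ` {1..})" "(\<lambda>k. hd (R' k)) ` {1..} = hd ` (R' ` {1..})"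
    by auto
  moreover have "R ` {1..} = R' ` {1..}"
    using R R' by (simp add: lists_realizations_def)
  ultimately have "hd (R k) = hd (R' k)"
    using strict_mono_range_unique[of "\<lambda>k. hd (R k)" "\<lambda>k. hd (R' k)"] k R R'
    unfolding lists_realizations_def by metis
  moreover have "R k \<in> {ms. realization w ms}" "R' k \<in> {ms. realization w ms}"
    using R R' k unfolding lists_realizations_def by blast+
  ultimately show ?thesis using path_unique unfolding realization_iff by blast
qed

lemma scenario_parameters_unique:
  assumes "scenario_parameters w A B C D" "scenario_parameters w A' B' C' D'"
  shows "A = A' \<and> B = B' \<and> C = C' \<and> D = D'"
proof -
  from assms(1) obtain R where R: "lists_realizations w R"
    "\<And>k. k \<ge> 1 \<Longrightarrow> hd (R k) = A * int k - B \<and> last (R k) = C * int k - D"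
    by (auto simp: scenario_parameters_def)
  from assms(2) obtain R' where R': "lists_realizations w R'"
    "\<And>k. k \<ge> 1 \<Longrightarrow> hd (R' k) = A' * int k - B' \<and> last (R' k) = C' * int k - D'"
    by (auto simp: scenario_parameters_def)
  have "A * int k - B = A' * int k - B' \<and> C * int k - D = C' * int k - D'" if "k \<ge> 1" for k
    using R(2)[OF that] R'(2)[OF that] lists_realizations_unique[OF R(1) R'(1) that] by simp
  \<comment> \<open>Affine functions of \<open>k\<close> that agree at 1 and 2 have the same
    coefficients.\<close>
  from this[of 1] this[of 2] show ?thesis by simp
qed

lemma scenario_parameters_eqs:
  assumes "scenario_parameters w A B C D"
  shows "startperiod w = A" "startphase w = B" "endperiod w = C" "endphase w = D"
  unfolding startperiod_def startphase_def endperiod_def endphase_def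
  using assms scenario_parameters_unique[OF assms] by (blast intro!: the_equality)+

section \<open>Reading the parameters off a progression\<close>

text \<open>In \<open>reach\<close> the index runs over all integers. The bounds on \<open>B\<close>
  make term 0 nonpositive and term 1 positive, so the positive startnumbers are exactly those with
  index at least 1, already in increasing order.\<close>

lemma scenario_parametersI:
  assumes w: "scenario w"
    and reach: "\<And>M N. reaches w M N \<and> odd N \<longleftrightarrow> (\<exists>k. M = A * k - B \<and> N = C * k - D)"
    and A: "even A" "0 \<le> B" "B < A"
  shows "scenario_parameters w A B C D"
proof -
  have reach_k: "reaches w (A * k - B) (C * k - D)" and odds: "odd (A * k - B)" "odd (C * k - D)" for k
  proof -
    show r: "reaches w (A * k - B) (C * k - D)" and "odd (C * k - D)"
      using reach[of "A * k - B" "C * k - D"] by auto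
    show "odd (A * k - B)" by (rule scenario_reaches_odd[OF w r])
  qed
  \<comment> \<open>Term 0 shows that both phases are odd; the endnumber of term 1 then forces
    \<open>C\<close> to be even.\<close>
  have pars: "odd B" "odd D" "even C"
    using odds(1)[of 0] odds(2)[of 0] odds(2)[of 1] by auto
  obtain R0 where R0: "\<And>k. path w (R0 k)" "\<And>k. hd (R0 k) = A * k - B"
      "\<And>k. last (R0 k) = C * k - D"
    using reach_k unfolding reaches_def by metis
  define R where "R k = R0 (int k)" for k :: nat
  have pos: "A * k - B > 0 \<longleftrightarrow> k \<ge> 1" for k :: int
  proof
    assume "k \<ge> 1"
    with A have "A * 1 \<le> A * k" by (intro mult_left_mono) auto
    with A show "A * k - B > 0" by linarith
  next
    assume "A * k - B > 0"
    with A have "A * k > 0" by simp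
    with A show "k \<ge> 1" by (simp add: zero_less_mult_iff)
  qed
  have "R ` {1..} = {ms. realization w ms}"
  proof (intro equalityI subsetI)
    fix ms assume "ms \<in> R ` {1..}"
    then show "ms \<in> {ms. realization w ms}"
      using R0 pos pars A(1) by (auto simp: R_def realization_iff)
  next
    fix ms assume "ms \<in> {ms. realization w ms}"
    then have ms: "path w ms" "hd ms > 0" "odd (last ms)"
      by (auto simp: realization_iff)
    then obtain k where k: "hd ms = A * k - B"
      using reach[of "hd ms" "last ms"] by (auto simp: reaches_def)
    with ms pos have "k \<ge> 1" by simp
    moreover have "ms = R0 k"
      by (rule path_unique[OF ms(1)]) (simp_all add: R0 k)
    ultimately have "ms = R (nat k)" "nat k \<ge> 1" by (simp_all add: R_def)
    then show "ms \<in> R ` {1..}" by blast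
  qed
  moreover have "strict_mono_on {1..} (\<lambda>k. hd (R k))"
    using A by (intro strict_mono_onI) (simp add: R_def R0)
  ultimately have "lists_realizations w R"
    by (simp add: lists_realizations_def)
  moreover have "hd (R k) = A * int k - B \<and> last (R k) = C * int k - D" for k
    by (simp add: R_def R0)
  ultimately show ?thesis
    unfolding scenario_parameters_def using pars A(1) by blast
qed

section \<open>Start- and endnumbers as arithmetic progressions\<close>

text \<open>Since \<open>Q\<close> is odd, the parity of \<open>b + Q * t\<close> alternates with
  \<open>t\<close>, so prescribing it keeps every second term. The new first term is the old first
  or second one, which gives the doubled bounds.\<close>

lemma odd_progression_halve:
  fixes P Q a b :: int
  assumes "odd Q" "0 < a" "a \<le> P" "0 < b" "b \<le> Q"
  obtains a' b' where "0 < a'" "a' \<le> 2 * P" "0 < b'" "b' \<le> 2 * Q" "even b' \<longleftrightarrow> e"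
    "\<And>M K. (\<exists>t. M = a + P * t \<and> K = b + Q * t) \<and> (even K \<longleftrightarrow> e) \<longleftrightarrow>
       (\<exists>t. M = a' + 2 * P * t \<and> K = b' + 2 * Q * t)"
proof -
  \<comment> \<open>Index of the first term with the prescribed parity.\<close>
  define d :: int where "d = (if even b \<longleftrightarrow> e then 0 else 1)"
  have d: "even (b + Q * d) \<longleftrightarrow> e" using assms(1) by (auto simp: d_def)
  have eq: "(\<exists>t. M = a + P * t \<and> K = b + Q * t) \<and> (even K \<longleftrightarrow> e) \<longleftrightarrow>
      (\<exists>t. M = (a + P * d) + 2 * P * t \<and> K = (b + Q * d) + 2 * Q * t)" (is "?l \<longleftrightarrow> ?r") for M K
  proof
    assume ?l
    then obtain t where t: "M = a + P * t" "K = b + Q * t" "even K \<longleftrightarrow> e" by blast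
    have "even (t - d)" using t d assms(1) by auto
    then obtain s where "t = 2 * s + d" by (metis diff_eq_eq dvdE)
    with t show ?r by (auto simp: algebra_simps intro!: exI[of _ s])
  next
    assume ?r
    then obtain t where t: "M = (a + P * d) + 2 * P * t" "K = (b + Q * d) + 2 * Q * t" by blast
    then have "even K \<longleftrightarrow> e" using d by simp
    with t show ?l by (auto simp: algebra_simps intro!: exI[of _ "d + 2 * t"])
  qed
  show ?thesis
    by (rule that[OF _ _ _ _ d eq]) (use assms in \<open>auto simp: d_def\<close>)
qed

text \<open>The parity demanded by an appended letter doubles both steps; the operation then turns
  the end step \<open>2 * Q\<close> into \<open>Q\<close> for a down and into \<open>3 * Q\<close>
  for a spike. The bounds on the first term carry over.\<close>

lemma reaches_progression:
  "\<exists>a b. 0 < a \<and> a \<le> 2 ^ length w \<and> 0 < b \<and> b \<le> 3 ^ count_list w Spike \<and>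
     (\<forall>M N. reaches w M N \<longleftrightarrow>
        (\<exists>t. M = a + 2 ^ length w * t \<and> N = b + 3 ^ count_list w Spike * t))"
proof (induction w rule: rev_induct)
  case Nil
  show ?case
    by (rule exI[of _ 1], rule exI[of _ 1])
      (auto simp: reaches_Nil intro: exI[of _ "_ - 1"])
next
  case (snoc x w)
  define P Q :: int where "P = 2 ^ length w" and "Q = 3 ^ count_list w Spike"
  have Q: "odd Q" by (simp add: Q_def)
  from snoc obtain a b where ab: "0 < a" "a \<le> P" "0 < b" "b \<le> Q"
    "\<And>M N. reaches w M N \<longleftrightarrow> (\<exists>t. M = a + P * t \<and> N = b + Q * t)"
    unfolding P_def Q_def by blast
  obtain a' b' where *: "0 < a'" "a' \<le> 2 * P" "0 < b'" "b' \<le> 2 * Q" "even b' \<longleftrightarrow> x = Down"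
    "\<And>M K. (\<exists>t. M = a + P * t \<and> K = b + Q * t) \<and> (even K \<longleftrightarrow> x = Down) \<longleftrightarrow>
       (\<exists>t. M = a' + 2 * P * t \<and> K = b' + 2 * Q * t)"
    using odd_progression_halve[OF Q ab(1-4), of "x = Down"] by blast
  show ?case
  proof (cases x)
    case Down
    with * obtain c where c: "b' = 2 * c" by auto
    have "reaches (w @ [x]) M N \<longleftrightarrow> (\<exists>t. M = a' + 2 * P * t \<and> N = c + Q * t)" for M N
    proof -
      have "reaches (w @ [x]) M N \<longleftrightarrow>
          (\<exists>K. ((\<exists>t. M = a + P * t \<and> K = b + Q * t) \<and> (even K \<longleftrightarrow> x = Down)) \<and> N = K div 2)"
        unfolding reaches_snoc ab(5) using Down by auto
      also have "\<dots> \<longleftrightarrow> (\<exists>t. M = a' + 2 * P * t \<and> N = (b' + 2 * Q * t) div 2)"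
        unfolding *(6) by blast
      also have "\<dots> \<longleftrightarrow> (\<exists>t. M = a' + 2 * P * t \<and> N = c + Q * t)"
      proof -
        have "(b' + 2 * Q * t) div 2 = c + Q * t" for t
          using c by simp
        then show ?thesis by simp
      qed
      finally show ?thesis .
    qed
    with * Down c show ?thesis
      by (intro exI[of _ a'] exI[of _ c]) (auto simp: P_def Q_def)
  next
    case Spike
    with * obtain c where c: "b' = 2 * c + 1" by (auto elim: oddE)
    \<comment> \<open>The constant \<open>3 * c + 2\<close> is the spike image of
      \<open>b' = 2 * c + 1\<close>.\<close>
    have "reaches (w @ [x]) M N \<longleftrightarrow> (\<exists>t. M = a' + 2 * P * t \<and> N = 3 * c + 2 + 3 * Q * t)" for M N
    proof -
      have "reaches (w @ [x]) M N \<longleftrightarrow>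
          (\<exists>K. ((\<exists>t. M = a + P * t \<and> K = b + Q * t) \<and> (even K \<longleftrightarrow> x = Down)) \<and>
            N = (3 * K + 1) div 2)"
        unfolding reaches_snoc ab(5) using Spike by auto
      also have "\<dots> \<longleftrightarrow> (\<exists>t. M = a' + 2 * P * t \<and> N = (3 * (b' + 2 * Q * t) + 1) div 2)"
        unfolding *(6) by blast
      also have "\<dots> \<longleftrightarrow> (\<exists>t. M = a' + 2 * P * t \<and> N = 3 * c + 2 + 3 * Q * t)"
      proof -
        have "3 * (b' + 2 * Q * t) + 1 = 2 * (3 * c + 2 + 3 * Q * t)" for t
          using c by (simp add: algebra_simps)
        then have "(3 * (b' + 2 * Q * t) + 1) div 2 = 3 * c + 2 + 3 * Q * t" for t
          by simp
        then show ?thesis by simp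
      qed
      finally show ?thesis .
    qed
    with * Spike c show ?thesis
      by (intro exI[of _ a'] exI[of _ "3 * c + 2"]) (auto simp: P_def Q_def)
  qed
qed

text \<open>Reindexing by 1 or 2 makes \<open>Y\<close> odd, so that odd endnumbers correspond to
  even \<open>s\<close>. The same choice puts both phases in the lower or both in the upper half of
  their ranges; this equivalence later keeps the two \<open>mod\<close> reductions in step.\<close>

lemma reaches_phases:
  obtains X Y :: int where "0 \<le> X" "X < 2 * 2 ^ length w" "0 \<le> Y" "Y < 2 * 3 ^ count_list w Spike"
    "odd Y" "X < 2 ^ length w \<longleftrightarrow> Y < 3 ^ count_list w Spike"
    "\<And>M N. reaches w M N \<longleftrightarrow>
       (\<exists>s. M = 2 ^ length w * s - X \<and> N = 3 ^ count_list w Spike * s - Y)"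
proof -
  define P Q :: int where "P = 2 ^ length w" and "Q = 3 ^ count_list w Spike"
  have Q: "odd Q" by (simp add: Q_def)
  from reaches_progression[of w] obtain a b where ab: "0 < a" "a \<le> P" "0 < b" "b \<le> Q"
    "\<And>M N. reaches w M N \<longleftrightarrow> (\<exists>t. M = a + P * t \<and> N = b + Q * t)"
    unfolding P_def Q_def by blast
  define t0 :: int where "t0 = (if even b then 1 else 2)"
  have "odd (Q * t0 - b)" using Q by (auto simp: t0_def)
  moreover have "reaches w M N \<longleftrightarrow> (\<exists>s. M = P * s - (P * t0 - a) \<and> N = Q * s - (Q * t0 - b))" for M N
  proof -
    have "(\<exists>t. M = a + P * t \<and> N = b + Q * t) \<longleftrightarrow>
        (\<exists>s. M = a + P * (s - t0) \<and> N = b + Q * (s - t0))"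
      by (metis add_diff_cancel_right')
    then show ?thesis unfolding ab(5) by (simp add: algebra_simps)
  qed
  ultimately show ?thesis
    using ab that[of "P * t0 - a" "Q * t0 - b"] unfolding P_def[symmetric] Q_def[symmetric]
    by (auto simp: t0_def split: if_splits)
qed

section \<open>The effect of a final down on the parameters\<close>

theorem proposition4p2:
  fixes S S' :: "collatz_op list"
    and A_M B_M A_N B_N A'_M B'_M A'_N B'_N :: int
  assumes "scenario S"
    and "A_M = startperiod S" and "B_M = startphase S"
    and "A_N = endperiod S" and "B_N = endphase S"
    and "S' = S @ [Down]"
    and "A'_M = startperiod S'" and "B'_M = startphase S'"
    and "A'_N = endperiod S'" and "B'_N = endphase S'"
  shows "(odd ((B_N + A_N div 2) div 2) \<longrightarrow>
            A'_M = 2 * A_M \<and>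
            B'_M = B_M + A_M div 2 \<and>
            A'_N = A_N \<and>
            B'_N = (B_N + A_N div 2) div 2) \<and>
         (even ((B_N + A_N div 2) div 2) \<longrightarrow>
            A'_M = 2 * A_M \<and>
            B'_M = (B_M + 3 * (A_M div 2)) mod A'_M \<and>
            A'_N = A_N \<and>
            B'_N = ((B_N + 3 * (A_N div 2)) div 2) mod A_N)"
proof -
  define P Q :: int where "P = 2 ^ length S" and "Q = 3 ^ count_list S Spike"
  obtain X Y where XY: "0 \<le> X" "X < 2 * P" "0 \<le> Y" "Y < 2 * Q" "odd Y" "X < P \<longleftrightarrow> Y < Q"
    and reach: "\<And>M N. reaches S M N \<longleftrightarrow> (\<exists>s. M = P * s - X \<and> N = Q * s - Y)"
    using reaches_phases[of S] unfolding P_def Q_def by metis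
  have Q: "odd Q" by (simp add: Q_def)
  \<comment> \<open>This identifies \<open>X\<close> and \<open>Y\<close> with the phases of
    \<open>S\<close>, and \<open>P\<close> and \<open>Q\<close> with half of its periods.\<close>
  have "scenario_parameters S (2 * P) X (2 * Q) Y"
  proof (rule scenario_parametersI[OF assms(1)])
    show "reaches S M N \<and> odd N \<longleftrightarrow> (\<exists>k. M = 2 * P * k - X \<and> N = 2 * Q * k - Y)" for M N
    proof
      assume "reaches S M N \<and> odd N"
      then obtain s where s: "M = P * s - X" "N = Q * s - Y" "odd N" using reach by blast
      then have "even s" using Q XY(5) by simp
      then obtain k where "s = 2 * k" by blast
      with s show "\<exists>k. M = 2 * P * k - X \<and> N = 2 * Q * k - Y" by (intro exI[of _ k]) simp
    next
      assume "\<exists>k. M = 2 * P * k - X \<and> N = 2 * Q * k - Y"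
      then obtain k where k: "M = P * (2 * k) - X" "N = Q * (2 * k) - Y"
        by (metis mult.assoc mult.commute)
      with reach have "reaches S M N" by blast
      with k XY(5) show "reaches S M N \<and> odd N" by simp
    qed
  qed (use XY in auto)
  note S = scenario_parameters_eqs[OF this]
  have S': "scenario S'" using assms(1,6) by (auto simp: scenario_def)
  \<comment> \<open>The terms kept are \<open>s = 4 * k + r\<close>, whose halved endnumber is
    \<open>2 * Q * k - Z\<close>. The bounds \<open>X\<close> select the representative of
    \<open>r\<close> modulo 4 for which the first realization has \<open>k = 1\<close>.\<close>
  have params': "scenario_parameters S' (4 * P) (X - P * r) (2 * Q) Z"
    if Z: "Y - Q * r = 2 * Z" "odd Z" and X: "0 \<le> X - P * r" "X - P * r < 4 * P" for r Z
  proof (rule scenario_parametersI[OF S'])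
    show "reaches S' M N \<and> odd N \<longleftrightarrow>
        (\<exists>k. M = 4 * P * k - (X - P * r) \<and> N = 2 * Q * k - Z)" for M N
    proof
      assume "reaches S' M N \<and> odd N"
      then obtain s where s: "M = P * s - X" "Q * s - Y = 2 * N" "odd N"
        using reach assms(6) reaches_snoc_Down by metis
      \<comment> \<open>Odd \<open>Q\<close> passes the factor 2 on to \<open>s - r\<close>; a
        second factor 2 comes from \<open>N + Z\<close>, a sum of two odd numbers. Hence
        \<open>s\<close> and \<open>r\<close> agree modulo 4.\<close>
      have "Q * (s - r) = 2 * (N + Z)" using s Z by (simp add: algebra_simps)
      then have "even (s - r)" using Q by (metis dvd_triv_left even_mult_iff)
      then obtain j where j: "s - r = 2 * j" by blast
      with \<open>Q * (s - r) = 2 * (N + Z)\<close> have NZ: "N + Z = Q * j" by simp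
      then have "even j" using s(3) Z(2) Q by (metis even_mult_iff odd_even_add)
      then obtain k where k: "j = 2 * k" by blast
      from j k have "s = 4 * k + r" by simp
      with s k NZ show "\<exists>k. M = 4 * P * k - (X - P * r) \<and> N = 2 * Q * k - Z"
        by (intro exI[of _ k]) (simp add: algebra_simps)
    next
      assume "\<exists>k. M = 4 * P * k - (X - P * r) \<and> N = 2 * Q * k - Z"
      then obtain k where k: "M = 4 * P * k - (X - P * r)" "N = 2 * Q * k - Z" by blast
      then have "M = P * (4 * k + r) - X" "2 * N = Q * (4 * k + r) - Y"
        using Z(1) by (simp_all add: algebra_simps)
      with reach have "reaches S M (2 * N)" by blast
      then have "reaches S' M N" using assms(6) by (simp add: reaches_snoc_Down)
      with k Z(2) show "reaches S' M N \<and> odd N" by simp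
    qed
  qed (use X in auto)
  \<comment> \<open>\<open>Z\<close> is the number whose parity splits the theorem, and it belongs
    to the class \<open>r = -1\<close>.\<close>
  obtain Z where Z: "Y + Q = 2 * Z" using XY(5) Q by (metis dvdE odd_even_add)
  show ?thesis
  proof (cases "odd Z")
    case True
    have "scenario_parameters S' (4 * P) (X + P) (2 * Q) Z"
      using params'[of "-1" Z] Z True XY by simp
    from scenario_parameters_eqs[OF this] True S Z show ?thesis
      using assms(2-5,7-10) by simp
  next
    case False
    \<comment> \<open>For even \<open>Z\<close> the class is the other odd one, that of
      \<open>-3\<close> and \<open>1\<close>, where adding or subtracting the odd \<open>Q\<close>
      makes the endphase odd. The sign of \<open>X - P\<close> decides which representative meets
      the bounds.\<close>
    have half: "(Y + 3 * Q) div 2 = Z + Q" using Z by simp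
    show ?thesis
    proof (cases "X < P")
      case True
      \<comment> \<open>Here \<open>X < P\<close> and \<open>Y < Q\<close>, so both remainders in
        the claim are already reduced.\<close>
      have "scenario_parameters S' (4 * P) (X + 3 * P) (2 * Q) (Z + Q)"
        using params'[of "-3" "Z + Q"] Z False Q XY True by (simp add: mult.commute)
      from scenario_parameters_eqs[OF this] False S Z half XY True show ?thesis
        using assms(2-5,7-10) by simp
    next
      case ge: False
      \<comment> \<open>Here \<open>P\<close> is at most \<open>X\<close> and \<open>Q\<close> at
        most \<open>Y\<close>, so each \<open>mod\<close> removes exactly one period.\<close>
      have "scenario_parameters S' (4 * P) (X - P) (2 * Q) (Z - Q)"
        using params'[of 1 "Z - Q"] Z False Q XY ge by simp
      moreover have "(X + 3 * P) mod (4 * P) = X - P"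
        using XY ge mod_pos_pos_trivial[of "X - P" "4 * P"] mod_add_self2[of "X - P" "4 * P"]
        by (simp add: algebra_simps)
      moreover have "(Z + Q) mod (2 * Q) = Z - Q"
        using XY ge Z mod_pos_pos_trivial[of "Z - Q" "2 * Q"] mod_add_self2[of "Z - Q" "2 * Q"]
        by (simp add: algebra_simps)
      ultimately show ?thesis
        using scenario_parameters_eqs[of S'] False S Z half assms(2-5,7-10) by simp
    qed
  qed
qed

end
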